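(* Let $R$ be a principal ideal domain and let $N$ be an $R$-module. Then the following hold: (1) If every free $R$-module is $\text{Red}$-$N$-injective, then every submodule of every free $R$-module is $\text{Red}$-$N$-injective. (2) If every projective $R$-module is $\text{Red}$-$N$-injective, then every submodule of every projective $R$-module is $\text{Red}$-$N$-injective. (3) Every projective $R$-module is $\text{Red}$-$N$-injective if and only if every free $R$-module is $\text{Red}$-$N$-injective.
   Context: All modules are unital right $R$-modules. An $R$-module $M$ is reduced if for all $r\in R$ and $m\in M$, $mr^{2}=0$ implies $mr=0$; a submodule is reduced if it is reduced as a module. $\text{Red}(M)$ denotes the sum of all reduced submodules of $M$. A module $M$ is semi-reduced if $\text{Red}(M)=M$; a submodule is semi-reduced if it is so as a module. For $R$-modules $M$ and $N$, $M$ is $\text{Red}$-$N$-injective if for every semi-reduced submodule $K$ of $N$, every $R$-homomorphism $f:K\rightarrow M$ extends to an $R$-homomorphism $N\rightarrow M$. *)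

theory Defs
  imports
    "HOL-Algebra.Ring_Divisibility"
    "Jordan_Normal_Form.Missing_VectorSpace"
begin

text \<open>
  The base ring is commutative, so the left modules of \<^locale>\<open>module\<close> serve as right modules.
  As a module in its own right, a submodule \<open>K\<close> of \<open>M\<close> is \<open>M\<lparr>carrier := K\<rparr>\<close>.
\<close>

definition reduced_module :: "('a, 'r) ring_scheme \<Rightarrow> ('a, 'm, 's) module_scheme \<Rightarrow> bool" where
  "reduced_module R M \<longleftrightarrow>
     (\<forall>r\<in>carrier R. \<forall>m\<in>carrier M.
        (r [^]\<^bsub>R\<^esub> (2::nat)) \<odot>\<^bsub>M\<^esub> m = \<zero>\<^bsub>M\<^esub> \<longrightarrow> r \<odot>\<^bsub>M\<^esub> m = \<zero>\<^bsub>M\<^esub>)"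

text \<open>The sum of a family of submodules: all finite sums of elements of its members.\<close>

definition Red :: "('a, 'r) ring_scheme \<Rightarrow> ('a, 'm, 's) module_scheme \<Rightarrow> 'm set" where
  "Red R M = {\<Oplus>\<^bsub>M\<^esub>K\<in>\<K>. x K | \<K> x. finite \<K> \<and>
     (\<forall>K\<in>\<K>. submodule R K M \<and> reduced_module R (M\<lparr>carrier := K\<rparr>) \<and> x K \<in> K)}"

definition semi_reduced :: "('a, 'r) ring_scheme \<Rightarrow> ('a, 'm, 's) module_scheme \<Rightarrow> bool" where
  "semi_reduced R M \<longleftrightarrow> Red R M = carrier M"

definition Red_injective ::
  "('a, 'r) ring_scheme \<Rightarrow> ('a, 'n, 't) module_scheme \<Rightarrow> ('a, 'm, 's) module_scheme \<Rightarrow> bool" where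
  "Red_injective R N M \<longleftrightarrow>
     (\<forall>K. submodule R K N \<and> semi_reduced R (N\<lparr>carrier := K\<rparr>) \<longrightarrow>
        (\<forall>f\<in>module_hom R (N\<lparr>carrier := K\<rparr>) M. \<exists>g\<in>module_hom R N M. \<forall>x\<in>K. g x = f x))"

definition free_module :: "('a, 'r) ring_scheme \<Rightarrow> ('a, 'm, 's) module_scheme \<Rightarrow> bool" where
  "free_module R M \<longleftrightarrow> module R M \<and>
     (\<exists>B\<subseteq>carrier M. module.span R M B = carrier M \<and> \<not> module.lin_dep R M B)"

definition lifts_along_epis ::
  "('a, 'r) ring_scheme \<Rightarrow> ('a, 'p, 's) module_scheme \<Rightarrow> ('a, 'c, 't) module_scheme
    \<Rightarrow> ('a, 'd, 'u) module_scheme \<Rightarrow> bool" where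
  "lifts_along_epis R P A B \<longleftrightarrow>
     (\<forall>g\<in>module_hom R A B. g ` carrier A = carrier B \<longrightarrow>
        (\<forall>f\<in>module_hom R P B. \<exists>h\<in>module_hom R P A. \<forall>x\<in>carrier P. g (h x) = f x))"

text \<open>
  A definition cannot quantify over the carrier types of the test modules \<open>A\<close> and \<open>B\<close>. The types
  below are large enough: \<open>projective_module_lifts\<close> yields the lifting property for
  \<open>A\<close> and \<open>B\<close> over arbitrary types.
\<close>

definition projective_module :: "('a, 'r) ring_scheme \<Rightarrow> ('a, 'p) module \<Rightarrow> bool" where
  "projective_module R P \<longleftrightarrow> module R P \<and>
     (\<forall>(A :: ('a, 'p \<Rightarrow> 'a) module) (B :: ('a, 'p) module).
        module R A \<and> module R B \<longrightarrow> lifts_along_epis R P A B)"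

definition finsupp_module :: "('a, 'r) ring_scheme \<Rightarrow> 'p set \<Rightarrow> ('a, 'p \<Rightarrow> 'a) module" where
  "finsupp_module R X =
     \<lparr>carrier = {c. range c \<subseteq> carrier R \<and> finite {p. c p \<noteq> \<zero>\<^bsub>R\<^esub>} \<and> {p. c p \<noteq> \<zero>\<^bsub>R\<^esub>} \<subseteq> X},
      mult = (\<lambda>c d p. \<zero>\<^bsub>R\<^esub>), one = (\<lambda>p. \<zero>\<^bsub>R\<^esub>), zero = (\<lambda>p. \<zero>\<^bsub>R\<^esub>),
      add = (\<lambda>c d p. c p \<oplus>\<^bsub>R\<^esub> d p), smult = (\<lambda>a c p. a \<otimes>\<^bsub>R\<^esub> c p)\<rparr>"

definition finsupp_eval ::
  "('a, 'r) ring_scheme \<Rightarrow> ('a, 'm, 's) module_scheme \<Rightarrow> ('p \<Rightarrow> 'm) \<Rightarrow> ('p \<Rightarrow> 'a) \<Rightarrow> 'm" where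
  "finsupp_eval R M \<phi> c = (\<Oplus>\<^bsub>M\<^esub>p\<in>{p. c p \<noteq> \<zero>\<^bsub>R\<^esub>}. c p \<odot>\<^bsub>M\<^esub> \<phi> p)"

lemma finsupp_moduleD:
  assumes "c \<in> carrier (finsupp_module R X)"
  shows "c p \<in> carrier R" "finite {p. c p \<noteq> \<zero>\<^bsub>R\<^esub>}" "{p. c p \<noteq> \<zero>\<^bsub>R\<^esub>} \<subseteq> X"
  using assms by (auto simp: finsupp_module_def)

lemma (in cring) finsupp_module_closed:
  assumes "c \<in> carrier (finsupp_module R X)" "d \<in> carrier (finsupp_module R X)" "a \<in> carrier R"
  shows "(\<lambda>p. c p \<oplus> d p) \<in> carrier (finsupp_module R X)"
    "(\<lambda>p. a \<otimes> c p) \<in> carrier (finsupp_module R X)"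
    "(\<lambda>p. \<ominus> c p) \<in> carrier (finsupp_module R X)"
proof -
  note c = finsupp_moduleD[OF assms(1)] and d = finsupp_moduleD[OF assms(2)]
  have "{p. c p \<oplus> d p \<noteq> \<zero>} \<subseteq> {p. c p \<noteq> \<zero>} \<union> {p. d p \<noteq> \<zero>}"
    "{p. a \<otimes> c p \<noteq> \<zero>} \<subseteq> {p. c p \<noteq> \<zero>}" "{p. \<ominus> c p \<noteq> \<zero>} \<subseteq> {p. c p \<noteq> \<zero>}"
    using assms(3) by auto
  then have "finite {p. c p \<oplus> d p \<noteq> \<zero>}" "{p. c p \<oplus> d p \<noteq> \<zero>} \<subseteq> X"
    "finite {p. a \<otimes> c p \<noteq> \<zero>}" "{p. a \<otimes> c p \<noteq> \<zero>} \<subseteq> X"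
    "finite {p. \<ominus> c p \<noteq> \<zero>}" "{p. \<ominus> c p \<noteq> \<zero>} \<subseteq> X"
    using c(2,3) d(2,3) by (blast intro: finite_subset finite_UnI)+
  then show "(\<lambda>p. c p \<oplus> d p) \<in> carrier (finsupp_module R X)"
    "(\<lambda>p. a \<otimes> c p) \<in> carrier (finsupp_module R X)"
    "(\<lambda>p. \<ominus> c p) \<in> carrier (finsupp_module R X)"
    using c(1) d(1) assms(3) by (auto simp: finsupp_module_def)
qed

lemma (in cring) finsupp_module_is_module: "module R (finsupp_module R X)"
proof (rule module_criteria, goal_cases)
  case 1 show ?case ..
next
  case 2 show ?case by (simp add: finsupp_module_def)
next
  case 3
  have "c \<oplus>\<^bsub>finsupp_module R X\<^esub> d \<in> carrier (finsupp_module R X)"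
    if c: "c \<in> carrier (finsupp_module R X)" and d: "d \<in> carrier (finsupp_module R X)" for c d
    using finsupp_module_closed(1)[OF c d zero_closed] by (simp add: finsupp_module_def)
  then show ?case by blast
next
  case 4
  have "\<exists>d\<in>carrier (finsupp_module R X). c \<oplus>\<^bsub>finsupp_module R X\<^esub> d = \<zero>\<^bsub>finsupp_module R X\<^esub>"
    if c: "c \<in> carrier (finsupp_module R X)" for c
    using finsupp_module_closed(3)[OF c c zero_closed] finsupp_moduleD(1)[OF c]
    by (intro bexI[of _ "\<lambda>p. \<ominus> c p"]) (auto simp: finsupp_module_def r_neg)
  then show ?case by blast
next
  case 5
  have "a \<odot>\<^bsub>finsupp_module R X\<^esub> c \<in> carrier (finsupp_module R X)"
    if "a \<in> carrier R" and c: "c \<in> carrier (finsupp_module R X)" for a c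
    using finsupp_module_closed(2)[OF c c that(1)] by (simp add: finsupp_module_def)
  then show ?case by blast
qed (auto simp: finsupp_module_def fun_eq_iff a_ac m_assoc l_distr r_distr
      image_subset_iff)

context module
begin

lemma finsupp_eval_superset:
  assumes c: "c \<in> carrier (finsupp_module R X)" and \<phi>: "\<phi> \<in> X \<rightarrow> carrier M"
    and S: "finite S" "{p. c p \<noteq> \<zero>} \<subseteq> S" "S \<subseteq> X"
  shows "finsupp_eval R M \<phi> c = (\<Oplus>\<^bsub>M\<^esub>p\<in>S. c p \<odot>\<^bsub>M\<^esub> \<phi> p)"
  unfolding finsupp_eval_def using S \<phi> finsupp_moduleD(1)[OF c]
  by (intro M.add.finprod_mono_neutral_cong_left) (auto simp: Pi_iff subset_iff)

lemma finsupp_eval_hom: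
  assumes \<phi>: "\<phi> \<in> X \<rightarrow> carrier M"
  shows "finsupp_eval R M \<phi> \<in> module_hom R (finsupp_module R X) M"
proof -
  let ?F = "finsupp_module R X"
  have cl: "finsupp_eval R M \<phi> c \<in> carrier M" if "c \<in> carrier ?F" for c
    unfolding finsupp_eval_def using finsupp_moduleD[OF that] \<phi>
    by (intro M.finsum_closed) (auto simp: Pi_iff subset_iff)
  have add: "finsupp_eval R M \<phi> (\<lambda>p. c p \<oplus> d p) =
      finsupp_eval R M \<phi> c \<oplus>\<^bsub>M\<^esub> finsupp_eval R M \<phi> d"
    if c: "c \<in> carrier ?F" and d: "d \<in> carrier ?F" for c d
  proof -
    let ?S = "{p. c p \<noteq> \<zero>} \<union> {p. d p \<noteq> \<zero>}"
    note c' = finsupp_moduleD[OF c] and d' = finsupp_moduleD[OF d]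
    have S: "finite ?S" "?S \<subseteq> X" "{p. c p \<oplus> d p \<noteq> \<zero>} \<subseteq> ?S"
      using c' d' by auto
    have \<phi>': "\<phi> p \<in> carrier M" if "p \<in> ?S" for p
      using \<phi> that S(2) by blast
    have "finsupp_eval R M \<phi> (\<lambda>p. c p \<oplus> d p) = (\<Oplus>\<^bsub>M\<^esub>p\<in>?S. (c p \<oplus> d p) \<odot>\<^bsub>M\<^esub> \<phi> p)"
      by (rule finsupp_eval_superset[OF R.finsupp_module_closed(1)[OF c d R.zero_closed] \<phi> S(1,3,2)])
    also have "\<dots> = (\<Oplus>\<^bsub>M\<^esub>p\<in>?S. c p \<odot>\<^bsub>M\<^esub> \<phi> p \<oplus>\<^bsub>M\<^esub> d p \<odot>\<^bsub>M\<^esub> \<phi> p)"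
      using c'(1) d'(1) \<phi>' by (intro M.finsum_cong') (auto simp: smult_l_distr)
    also have "\<dots> = (\<Oplus>\<^bsub>M\<^esub>p\<in>?S. c p \<odot>\<^bsub>M\<^esub> \<phi> p) \<oplus>\<^bsub>M\<^esub> (\<Oplus>\<^bsub>M\<^esub>p\<in>?S. d p \<odot>\<^bsub>M\<^esub> \<phi> p)"
      using c'(1) d'(1) \<phi>' by (intro M.finsum_addf) auto
    also have "\<dots> = finsupp_eval R M \<phi> c \<oplus>\<^bsub>M\<^esub> finsupp_eval R M \<phi> d"
      using finsupp_eval_superset[OF c \<phi> S(1) _ S(2)] finsupp_eval_superset[OF d \<phi> S(1) _ S(2)]
      by simp
    finally show ?thesis .
  qed
  have smult: "finsupp_eval R M \<phi> (\<lambda>p. a \<otimes> c p) = a \<odot>\<^bsub>M\<^esub> finsupp_eval R M \<phi> c"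
    if a: "a \<in> carrier R" and c: "c \<in> carrier ?F" for a c
  proof -
    let ?S = "{p. c p \<noteq> \<zero>}"
    note c' = finsupp_moduleD[OF c]
    have S: "{p. a \<otimes> c p \<noteq> \<zero>} \<subseteq> ?S"
      using a by auto
    have \<phi>': "\<phi> p \<in> carrier M" if "p \<in> ?S" for p
      using \<phi> that c'(3) by blast
    have "finsupp_eval R M \<phi> (\<lambda>p. a \<otimes> c p) = (\<Oplus>\<^bsub>M\<^esub>p\<in>?S. (a \<otimes> c p) \<odot>\<^bsub>M\<^esub> \<phi> p)"
      by (rule finsupp_eval_superset[OF R.finsupp_module_closed(2)[OF c c a] \<phi> c'(2) S c'(3)])
    also have "\<dots> = (\<Oplus>\<^bsub>M\<^esub>p\<in>?S. a \<odot>\<^bsub>M\<^esub> (c p \<odot>\<^bsub>M\<^esub> \<phi> p))"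
      using a c'(1) \<phi>' by (intro M.finsum_cong') (auto simp: smult_assoc1)
    also have "\<dots> = a \<odot>\<^bsub>M\<^esub> finsupp_eval R M \<phi> c"
      unfolding finsupp_eval_def using a c'(1,2) \<phi>'
      by (intro finsum_smult_ldistr[symmetric]) auto
    finally show ?thesis .
  qed
  show ?thesis
    using cl add smult by (auto simp: module_hom_def finsupp_module_def)
qed

lemma finsupp_eval_unit:
  assumes "x \<in> X" "\<phi> \<in> X \<rightarrow> carrier M"
  shows "\<exists>c\<in>carrier (finsupp_module R X). finsupp_eval R M \<phi> c = \<phi> x"
proof
  let ?c = "\<lambda>p. if p = x then \<one> else \<zero>"
  show c: "?c \<in> carrier (finsupp_module R X)"
    using assms(1) by (auto simp: finsupp_module_def intro: finite_subset[of _ "{x}"])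
  have "finsupp_eval R M \<phi> ?c = (\<Oplus>\<^bsub>M\<^esub>p\<in>{x}. ?c p \<odot>\<^bsub>M\<^esub> \<phi> p)"
    using assms by (intro finsupp_eval_superset[OF c assms(2)]) auto
  also have "\<dots> = \<phi> x"
    using Pi_mem[OF assms(2,1)] by simp
  finally show "finsupp_eval R M \<phi> ?c = \<phi> x" .
qed

end

lemma module_hom_zero:
  assumes "module R M" "module R N" "f \<in> module_hom R M N"
  shows "f \<zero>\<^bsub>M\<^esub> = \<zero>\<^bsub>N\<^esub>"
proof -
  interpret M: module R M by fact
  interpret N: module R N by fact
  have "f (\<zero>\<^bsub>R\<^esub> \<odot>\<^bsub>M\<^esub> \<zero>\<^bsub>M\<^esub>) = \<zero>\<^bsub>R\<^esub> \<odot>\<^bsub>N\<^esub> f \<zero>\<^bsub>M\<^esub>"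
    by (rule module_hom_smult[OF assms(3) M.R.zero_closed M.M.zero_closed])
  then show ?thesis
    using module_hom_closed[OF assms(3)] by (simp add: Pi_iff)
qed

lemma module_hom_finsum:
  assumes "module R M" "module R N" "f \<in> module_hom R M N" "finite S" "u \<in> S \<rightarrow> carrier M"
  shows "f (\<Oplus>\<^bsub>M\<^esub>p\<in>S. u p) = (\<Oplus>\<^bsub>N\<^esub>p\<in>S. f (u p))"
  using assms(4,5)
proof (induction S)
  interpret M: module R M by fact
  interpret N: module R N by fact
  note fc = module_hom_closed[OF assms(3)]
  case empty
  then show ?case using module_hom_zero[OF assms(1-3)] by simp
next
  interpret M: module R M by fact
  interpret N: module R N by fact
  note fc = module_hom_closed[OF assms(3)]
  case (insert x S)
  then show ?case
    using fc module_hom_add[OF assms(3)] by (simp add: Pi_iff)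
qed

lemma module_hom_finsupp_eval:
  assumes "module R M" "module R N" "f \<in> module_hom R M N"
    and c: "c \<in> carrier (finsupp_module R X)" and \<phi>: "\<phi> \<in> X \<rightarrow> carrier M"
  shows "f (finsupp_eval R M \<phi> c) = finsupp_eval R N (\<lambda>p. f (\<phi> p)) c"
proof -
  interpret M: module R M by fact
  interpret N: module R N by fact
  note c' = finsupp_moduleD[OF c] and fc = module_hom_closed[OF assms(3)]
  have \<phi>': "\<phi> p \<in> carrier M" if "c p \<noteq> \<zero>\<^bsub>R\<^esub>" for p
    using \<phi> that c'(3) by blast
  have "f (finsupp_eval R M \<phi> c) = (\<Oplus>\<^bsub>N\<^esub>p\<in>{p. c p \<noteq> \<zero>\<^bsub>R\<^esub>}. f (c p \<odot>\<^bsub>M\<^esub> \<phi> p))"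
    unfolding finsupp_eval_def using c'(1) \<phi>'
    by (intro module_hom_finsum[OF assms(1-3) c'(2)]) auto
  also have "\<dots> = finsupp_eval R N (\<lambda>p. f (\<phi> p)) c"
    unfolding finsupp_eval_def using c'(1) \<phi>' fc module_hom_smult[OF assms(3)]
    by (intro N.M.finsum_cong') (auto simp: Pi_iff)
  finally show ?thesis .
qed

theorem projective_module_lifts:
  fixes A :: "('a, 'c, 't) module_scheme" and B :: "('a, 'd, 'u) module_scheme"
  assumes P: "projective_module R P" and A: "module R A" and B: "module R B"
  shows "lifts_along_epis R P A B"
  unfolding lifts_along_epis_def
proof (intro ballI impI)
  fix g f
  assume g: "g \<in> module_hom R A B" and surj: "g ` carrier A = carrier B"
    and f: "f \<in> module_hom R P B"
  have modP: "module R P" using P by (simp add: projective_module_def)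
  interpret P: module R P by fact
  interpret A: module R A by fact
  interpret B: module R B by fact
  let ?F = "finsupp_module R (carrier P)"
  have modF: "module R ?F" by (rule P.R.finsupp_module_is_module)
  define \<pi> where "\<pi> = finsupp_eval R P (\<lambda>p. p)"
  have \<pi>: "\<pi> \<in> module_hom R ?F P"
    unfolding \<pi>_def by (rule P.finsupp_eval_hom) auto
  have surj_\<pi>: "\<pi> ` carrier ?F = carrier P"
  proof
    show "\<pi> ` carrier ?F \<subseteq> carrier P" using module_hom_closed[OF \<pi>] by auto
    show "carrier P \<subseteq> \<pi> ` carrier ?F"
    proof
      fix x assume "x \<in> carrier P"
      from P.finsupp_eval_unit[OF this, of "\<lambda>p. p"] show "x \<in> \<pi> ` carrier ?F"
        by (auto simp: \<pi>_def image_iff)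
    qed
  qed
  have lift: "lifts_along_epis R P ?F P"
    using P modF modP by (simp add: projective_module_def)
  have id: "(\<lambda>x. x) \<in> module_hom R P P" by (simp add: module_hom_def)
  obtain \<sigma> where \<sigma>: "\<sigma> \<in> module_hom R P ?F" and \<pi>\<sigma>: "\<And>x. x \<in> carrier P \<Longrightarrow> \<pi> (\<sigma> x) = x"
    using lift[unfolded lifts_along_epis_def, rule_format, OF \<pi> surj_\<pi> id] by auto
  have "\<exists>a\<in>carrier A. g a = f p" if "p \<in> carrier P" for p
  proof -
    have "f p \<in> g ` carrier A" using module_hom_closed[OF f] that by (auto simp: surj)
    then show ?thesis by auto
  qed
  then obtain \<phi> where \<phi>: "\<And>p. p \<in> carrier P \<Longrightarrow> \<phi> p \<in> carrier A \<and> g (\<phi> p) = f p"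
    by metis
  define h where "h = finsupp_eval R A \<phi> \<circ> \<sigma>"
  have ev: "finsupp_eval R A \<phi> \<in> module_hom R ?F A"
    using \<phi> by (intro A.finsupp_eval_hom) auto
  show "\<exists>h\<in>module_hom R P A. \<forall>x\<in>carrier P. g (h x) = f x"
  proof (intro bexI ballI)
    show "h \<in> module_hom R P A"
      using ev \<sigma> by (simp add: h_def module_hom_def Pi_iff)
    fix x assume x: "x \<in> carrier P"
    have \<sigma>x: "\<sigma> x \<in> carrier ?F" using module_hom_closed[OF \<sigma>] x by auto
    have supp: "{p. \<sigma> x p \<noteq> \<zero>\<^bsub>R\<^esub>} \<subseteq> carrier P" by (rule finsupp_moduleD(3)[OF \<sigma>x])
    have "g (h x) = finsupp_eval R B (\<lambda>p. g (\<phi> p)) (\<sigma> x)"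
      unfolding h_def comp_def using \<phi> by (intro module_hom_finsupp_eval[OF A B g \<sigma>x]) auto
    also have "\<dots> = finsupp_eval R B f (\<sigma> x)"
      unfolding finsupp_eval_def
      using \<phi> supp finsupp_moduleD(1)[OF \<sigma>x] module_hom_closed[OF f]
      by (intro B.M.finsum_cong') (auto simp: Pi_iff subset_iff)
    also have "\<dots> = f (\<pi> (\<sigma> x))"
      unfolding \<pi>_def by (intro module_hom_finsupp_eval[OF modP B f \<sigma>x, symmetric]) auto
    finally show "g (h x) = f x" using \<pi>\<sigma>[OF x] by simp
  qed
qed

end

theory Submission
  imports Defs
begin

text \<open>
  Over a principal ideal domain, a module is free iff it is projective iff it embeds into a module
  of finitely supported families, and the last property passes to submodules; all three claims
  follow, whatever \<open>N\<close> is. To find a basis of an embedded module, well-order the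
  index set. For every index \<open>b\<close>, the \<open>b\<close>-entries of the elements supported on indices \<open>\<le> b\<close> form an
  ideal; pick an element whose \<open>b\<close>-entry generates it. The elements picked at the indices with nonzero
  ideal form a basis: looking at leading entries shows independence, and spanning follows by
  well-founded induction on the leading index.
\<close>

section \<open>Orders and module homomorphisms\<close>

text \<open>Supplies leading indices: the support of a nonzero family and the set of indices
  occurring in a linear dependence are both finite and nonempty.\<close>

lemma linear_order_finite_max:
  assumes r: "linear_order_on UNIV r" and "finite S" "S \<noteq> {}"
  shows "\<exists>m\<in>S. \<forall>x\<in>S. (x, m) \<in> r"
  using assms(2,3)
proof (induction rule: finite_ne_induct)
  case (singleton x)
  then show ?case
    using r by (auto simp: order_on_defs refl_on_def)
next
  case (insert x S)
  then obtain m where m: "m \<in> S" "\<forall>y\<in>S. (y, m) \<in> r"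
    by blast
  have refl: "(x, x) \<in> r" and trans: "trans r" and total: "(x, m) \<in> r \<or> (m, x) \<in> r"
    using r by (cases "x = m"; auto simp: order_on_defs refl_on_def total_on_def)+
  from total show ?case
  proof
    assume "(x, m) \<in> r"
    then show ?thesis using m by blast
  next
    assume "(m, x) \<in> r"
    then have "\<forall>y\<in>S. (y, x) \<in> r"
      using m trans by (blast dest: transD)
    then show ?thesis using refl by blast
  qed
qed

lemma finsupp_module_sel:
  "c \<oplus>\<^bsub>finsupp_module R X\<^esub> d = (\<lambda>p. c p \<oplus>\<^bsub>R\<^esub> d p)"
  "a \<odot>\<^bsub>finsupp_module R X\<^esub> c = (\<lambda>p. a \<otimes>\<^bsub>R\<^esub> c p)"
  "\<zero>\<^bsub>finsupp_module R X\<^esub> = (\<lambda>p. \<zero>\<^bsub>R\<^esub>)"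
  by (simp_all add: finsupp_module_def)

lemma module_hom_comp:
  assumes "f \<in> module_hom R L M" "g \<in> module_hom R M N"
  shows "g \<circ> f \<in> module_hom R L N"
  using assms by (simp add: module_hom_def Pi_iff)

lemma module_hom_submodule:
  assumes "submodule R K M" "f \<in> module_hom R M N"
  shows "f \<in> module_hom R (M\<lparr>carrier := K\<rparr>) N"
  using assms submodule.subset[OF assms(1)] by (auto simp: module_hom_def Pi_iff subset_iff)

lemma module_hom_inv_into:
  assumes "module R M" and f: "f \<in> module_hom R M N" and inj: "inj_on f (carrier M)"
    and surj: "f ` carrier M = carrier N"
  shows "inv_into (carrier M) f \<in> module_hom R N M"
proof -
  interpret M: module R M by fact
  let ?g = "inv_into (carrier M) f"
  have g: "?g y \<in> carrier M" "f (?g y) = y" if "y \<in> carrier N" for y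
    using that surj by (auto simp: inv_into_into f_inv_into_f)
  have "?g (y \<oplus>\<^bsub>N\<^esub> z) = ?g y \<oplus>\<^bsub>M\<^esub> ?g z" if "y \<in> carrier N" "z \<in> carrier N" for y z
    using g[OF that(1)] g[OF that(2)] module_hom_add[OF f] inj
    by (intro inv_into_f_eq) auto
  moreover have "?g (a \<odot>\<^bsub>N\<^esub> y) = a \<odot>\<^bsub>M\<^esub> ?g y" if "a \<in> carrier R" "y \<in> carrier N" for a y
    using that(1) g[OF that(2)] module_hom_smult[OF f] inj
    by (intro inv_into_f_eq) auto
  ultimately show ?thesis
    using g(1) by (auto simp: module_hom_def)
qed

section \<open>Bases of submodules of free modules\<close>

text \<open>The classical theorem on submodules of free modules over a principal ideal domain,
  without restriction on the rank. An injective homomorphism takes the place of an inclusion, so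
  that it applies equally to projective modules and to their submodules.\<close>

lemma free_module_of_embedding:
  fixes R (structure) and M :: "('a, 'm, 's) module_scheme" and X :: "'i set"
  assumes "principal_domain R" and "module R M"
    and \<sigma>: "\<sigma> \<in> module_hom R M (finsupp_module R X)" and inj: "inj_on \<sigma> (carrier M)"
  shows "free_module R M"
proof -
  interpret principal_domain R by fact
  interpret M: module R M by fact
  have \<sigma>_mem: "\<sigma> x \<in> carrier (finsupp_module R X)" if "x \<in> carrier M" for x
    using module_hom_closed[OF \<sigma>] that by auto
  note \<sigma>_closed [simp, intro] = finsupp_moduleD(1)[OF \<sigma>_mem]
  note \<sigma>_finite = finsupp_moduleD(2)[OF \<sigma>_mem]
  have \<sigma>_add [simp]: "\<sigma> (x \<oplus>\<^bsub>M\<^esub> y) p = \<sigma> x p \<oplus> \<sigma> y p"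
    if "x \<in> carrier M" "y \<in> carrier M" for x y p
    using module_hom_add[OF \<sigma> that] by (simp add: finsupp_module_sel)
  have \<sigma>_smult [simp]: "\<sigma> (a \<odot>\<^bsub>M\<^esub> x) p = a \<otimes> \<sigma> x p"
    if "a \<in> carrier R" "x \<in> carrier M" for a x p
    using module_hom_smult[OF \<sigma> that] by (simp add: finsupp_module_sel)
  have \<sigma>_zero [simp]: "\<sigma> \<zero>\<^bsub>M\<^esub> p = \<zero>" for p
    using module_hom_zero[OF assms(2) finsupp_module_is_module \<sigma>] by (simp add: finsupp_module_sel)
  have \<sigma>_nonzero: "{p. \<sigma> x p \<noteq> \<zero>} \<noteq> {}" if "x \<in> carrier M" "x \<noteq> \<zero>\<^bsub>M\<^esub>" for x
  proof
    assume "{p. \<sigma> x p \<noteq> \<zero>} = {}"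
    then have "\<sigma> x = \<sigma> \<zero>\<^bsub>M\<^esub>" by (auto simp: fun_eq_iff)
    then show False using inj_onD[OF inj] that by auto
  qed
  \<comment> \<open>Meant for the terms of a dependence that do not reach its leading index
    \<open>p\<close>.\<close>
  have \<sigma>_lincomb: "\<sigma> (M.lincomb a A) p = \<zero>"
    if "finite A" "A \<subseteq> carrier M" "a \<in> A \<rightarrow> carrier R" "\<And>v. v \<in> A \<Longrightarrow> a v \<otimes> \<sigma> v p = \<zero>" for a A p
    using that
  proof (induction A)
    case (insert v A)
    have "M.lincomb a (insert v A) = a v \<odot>\<^bsub>M\<^esub> v \<oplus>\<^bsub>M\<^esub> M.lincomb a A"
      using insert.hyps insert.prems(1,2) M.lincomb_insert[of A a v] by auto
    then show ?case using insert by auto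
  qed (simp add: M.lincomb_def)

  \<comment> \<open>The whole index type is ordered rather than \<open>X\<close>. Entries outside
    \<open>X\<close> vanish, so the extra indices contribute only zero ideals.\<close>
  obtain r :: "('i \<times> 'i) set" where "well_order_on UNIV r"
    using well_order_on by blast
  then have lin: "linear_order_on UNIV r" and wf: "wf (r - Id)"
    by (auto simp: well_order_on_def)
  have antisym: "p = q" if "(p, q) \<in> r" "(q, p) \<in> r" for p q
    using lin that by (auto simp: order_on_defs dest: antisymD)
  have trans: "(p, s) \<in> r" if "(p, q) \<in> r" "(q, s) \<in> r" for p q s
    using lin that by (auto simp: order_on_defs dest: transD)
  define below where "below b = {x \<in> carrier M. \<forall>p. \<sigma> x p \<noteq> \<zero> \<longrightarrow> (p, b) \<in> r}" for b
  have below_M [dest]: "x \<in> carrier M" if "x \<in> below b" for x b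
    using that by (simp add: below_def)
  have below_zero: "\<zero>\<^bsub>M\<^esub> \<in> below b" for b
    by (simp add: below_def)
  have below_eq: "\<sigma> x p = \<zero>" if "x \<in> below b" "(p, b) \<notin> r" for x b p
    using that by (auto simp: below_def)
  have below_add: "x \<oplus>\<^bsub>M\<^esub> y \<in> below b" if "x \<in> below b" "y \<in> below b" for x y b
  proof -
    have "\<sigma> (x \<oplus>\<^bsub>M\<^esub> y) p = \<zero>" if "(p, b) \<notin> r" for p
      using below_eq[OF \<open>x \<in> below b\<close> that] below_eq[OF \<open>y \<in> below b\<close> that]
        below_M[OF \<open>x \<in> below b\<close>] below_M[OF \<open>y \<in> below b\<close>] by simp
    then show ?thesis using that by (auto simp: below_def)
  qed
  have below_smult: "a \<odot>\<^bsub>M\<^esub> x \<in> below b" if "a \<in> carrier R" "x \<in> below b" for a x b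
  proof -
    have "\<sigma> (a \<odot>\<^bsub>M\<^esub> x) p = \<zero>" if "(p, b) \<notin> r" for p
      using below_eq[OF \<open>x \<in> below b\<close> that] \<open>a \<in> carrier R\<close> below_M[OF \<open>x \<in> below b\<close>] by simp
    then show ?thesis using that by (auto simp: below_def)
  qed

  \<comment> \<open>The \<open>b\<close>-entries of \<open>below b\<close> form an ideal
    \<open>?I\<close>, which is principal; \<open>k\<close> is any element of \<open>below b\<close>
    whose \<open>b\<close>-entry is the generator.\<close>
  have "\<exists>k\<in>below b. \<forall>x\<in>below b. \<exists>a\<in>carrier R. \<sigma> x b = a \<otimes> \<sigma> k b" for b
  proof -
    let ?I = "(\<lambda>x. \<sigma> x b) ` below b"
    have "ideal ?I R"
    proof (rule idealI[OF ring_axioms])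
      show "subgroup ?I (add_monoid R)"
      proof (rule add.subgroupI)
        show "?I \<subseteq> carrier R" by auto
        show "?I \<noteq> {}" using below_zero by auto
        show "\<ominus> c \<in> ?I" if c: "c \<in> ?I" for c
        proof -
          obtain x where x: "x \<in> below b" "c = \<sigma> x b" using c by auto
          then have xM: "x \<in> carrier M" by auto
          have "\<sigma> (\<ominus> \<one> \<odot>\<^bsub>M\<^esub> x) b = \<ominus> c"
            using xM x(2) by (simp add: l_minus)
          then show ?thesis
            using below_smult[OF _ x(1), of "\<ominus> \<one>"] by force
        qed
        show "c \<oplus> d \<in> ?I" if cd: "c \<in> ?I" "d \<in> ?I" for c d
        proof -
          obtain x y where xy: "x \<in> below b" "c = \<sigma> x b" "y \<in> below b" "d = \<sigma> y b"
            using cd by auto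
          then have "\<sigma> (x \<oplus>\<^bsub>M\<^esub> y) b = c \<oplus> d" by (simp add: below_M)
          then show ?thesis using below_add[OF xy(1,3)] by force
        qed
      qed
    next
      fix c a assume "c \<in> ?I" and a: "a \<in> carrier R"
      then obtain x where x: "x \<in> below b" "c = \<sigma> x b" by auto
      then have xM: "x \<in> carrier M" by auto
      then have "\<sigma> (a \<odot>\<^bsub>M\<^esub> x) b = a \<otimes> c" using x a by simp
      then show "a \<otimes> c \<in> ?I" using below_smult[OF a x(1)] by force
      then show "c \<otimes> a \<in> ?I" using a x xM by (simp add: m_comm)
    qed
    then obtain g where g: "g \<in> carrier R" "?I = PIdl g"
      using exists_gen by blast
    have "g \<in> ?I"
      unfolding g(2) by (rule cgenideal_self[OF g(1)])
    then obtain k where k: "k \<in> below b" "\<sigma> k b = g"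
      by auto
    have "\<exists>a\<in>carrier R. \<sigma> x b = a \<otimes> g" if "x \<in> below b" for x
    proof -
      have "\<sigma> x b \<in> PIdl g" using that g(2) by auto
      then show ?thesis by (auto simp: cgenideal_def)
    qed
    then show ?thesis using k by auto
  qed
  then obtain k where k: "\<And>b. k b \<in> below b"
    and k_gen: "\<And>b x. x \<in> below b \<Longrightarrow> \<exists>a\<in>carrier R. \<sigma> x b = a \<otimes> \<sigma> (k b) b"
    by metis
  have kM [simp, intro]: "k b \<in> carrier M" for b
    using k by blast
  \<comment> \<open>For \<open>b\<close> in \<open>T\<close> the leading index of \<open>k b\<close>
    is exactly \<open>b\<close>. For \<open>b\<close> outside \<open>T\<close> the ideal is zero, so
    all of \<open>below b\<close> has zero \<open>b\<close>-entry, yet \<open>k b\<close> itself may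
    be nonzero.\<close>
  define T where "T = {b. \<sigma> (k b) b \<noteq> \<zero>}"
  have inj_k: "inj_on k T"
  proof (rule inj_onI)
    fix b c assume bc: "b \<in> T" "c \<in> T" "k b = k c"
    then have "\<sigma> (k c) b \<noteq> \<zero>" "\<sigma> (k b) c \<noteq> \<zero>" by (auto simp: T_def)
    then show "b = c" using k[of b] k[of c] by (auto simp: below_def intro: antisym)
  qed
  have BM: "k ` T \<subseteq> carrier M" by auto

  have indep: "\<not> M.lin_dep (k ` T)"
  proof
    assume "M.lin_dep (k ` T)"
    then obtain A a v where A: "finite A" "A \<subseteq> k ` T" "a \<in> A \<rightarrow> carrier R"
      and zero: "M.lincomb a A = \<zero>\<^bsub>M\<^esub>" and v: "v \<in> A" "a v \<noteq> \<zero>"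
      by (auto simp: M.lin_dep_def)
    \<comment> \<open>The dependence is moved from vectors to indices, where a maximum
      \<open>m\<close> exists; injectivity of \<open>k\<close> on \<open>T\<close> keeps the set
      finite.\<close>
    let ?S = "{b \<in> T. k b \<in> A \<and> a (k b) \<noteq> \<zero>}"
    have "finite (k ` ?S)"
      by (rule finite_subset[OF _ A(1)]) auto
    then have "finite ?S"
      by (rule finite_imageD) (rule inj_on_subset[OF inj_k], auto)
    moreover have "?S \<noteq> {}"
      using v A(2) by auto
    ultimately obtain m where m: "m \<in> ?S" and max: "\<forall>b\<in>?S. (b, m) \<in> r"
      using linear_order_finite_max[OF lin] by blast
    have AM: "A \<subseteq> carrier M" using A(2) by auto
    \<comment> \<open>Write \<open>w = k b\<close>. If the product were nonzero, maximality would
      give \<open>b\<close> \<le> \<open>m\<close> and the support of \<open>k b\<close> would give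
      \<open>m\<close> \<le> \<open>b\<close>, forcing \<open>w = k m\<close>.\<close>
    have "a w \<otimes> \<sigma> w m = \<zero>" if w: "w \<in> A - {k m}" for w
    proof (rule ccontr)
      assume nz: "a w \<otimes> \<sigma> w m \<noteq> \<zero>"
      obtain b where b: "b \<in> T" "w = k b" using w A(2) by auto
      have wR: "a w \<in> carrier R" "\<sigma> w m \<in> carrier R" using w A(3) AM by auto
      have "a w \<noteq> \<zero>" "\<sigma> w m \<noteq> \<zero>" using nz wR by auto
      then have "(b, m) \<in> r" "(m, b) \<in> r"
        using b w max k[of b] by (auto simp: below_def)
      then show False using antisym b w by blast
    qed
    then have rest: "\<sigma> (M.lincomb a (A - {k m})) m = \<zero>"
      using A AM by (intro \<sigma>_lincomb) auto
    have am: "a (k m) \<in> carrier R" using m A(3) by auto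
    have "M.lincomb a A = a (k m) \<odot>\<^bsub>M\<^esub> k m \<oplus>\<^bsub>M\<^esub> M.lincomb a (A - {k m})"
      using m by (intro M.lincomb_del2[OF A(1) AM A(3)]) auto
    moreover have "M.lincomb a (A - {k m}) \<in> carrier M"
      using AM A(3) by (intro M.lincomb_closed) auto
    ultimately have "a (k m) \<otimes> \<sigma> (k m) m = \<sigma> \<zero>\<^bsub>M\<^esub> m"
      using rest am zero by (metis M.smult_closed \<sigma>_add \<sigma>_smult \<sigma>_closed kM r_zero)
    \<comment> \<open>The \<open>m\<close>-entry of the dependence has shrunk to one product in a
      domain. Its first factor is nonzero as \<open>m\<close> lies in \<open>?S\<close>, its second
      as \<open>m\<close> lies in \<open>T\<close>.\<close>
    then have "a (k m) = \<zero> \<or> \<sigma> (k m) m = \<zero>"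
      using integral am by simp
    then show False using m by (simp add: T_def)
  qed

  interpret span: submodule R "M.span (k ` T)" M
    by (rule M.span_is_submodule[OF BM])
  \<comment> \<open>Subtracting a multiple of \<open>k b\<close> kills the \<open>b\<close>-entry,
    so the remainder is zero or has a strictly smaller leading index.\<close>
  have below_span: "below b \<subseteq> M.span (k ` T)" for b
    using wf
  proof (induction b)
    case (less b)
    show ?case
    proof
      fix x assume x: "x \<in> below b"
      then have xM: "x \<in> carrier M" by blast
      obtain a where a: "a \<in> carrier R" "\<sigma> x b = a \<otimes> \<sigma> (k b) b"
        using k_gen[OF x] by blast
      \<comment> \<open>Outside \<open>T\<close> the vector \<open>k b\<close> is not among the
        picked ones, so \<open>a\<close> is replaced by zero; the equation survives because both
        sides vanish.\<close>
      obtain a' where a': "a' \<in> carrier R" "a' \<odot>\<^bsub>M\<^esub> k b \<in> M.span (k ` T)" "\<sigma> x b = a' \<otimes> \<sigma> (k b) b"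
      proof (cases "b \<in> T")
        case True
        then show ?thesis
          using that[of a] a M.in_own_span[OF BM] by auto
      next
        case False
        then have "\<sigma> (k b) b = \<zero>" by (simp add: T_def)
        then show ?thesis
          using that[of \<zero>] a by simp
      qed
      define y where "y = x \<oplus>\<^bsub>M\<^esub> (\<ominus> a') \<odot>\<^bsub>M\<^esub> k b"
      have yM: "y \<in> carrier M" using xM a' by (simp add: y_def)
      have y_below: "y \<in> below b"
        unfolding y_def using a' x k by (intro below_add below_smult) auto
      have y_b: "\<sigma> y b = \<zero>"
        using xM a' by (simp add: y_def l_minus r_neg)
      have "y \<in> M.span (k ` T)"
      proof (cases "y = \<zero>\<^bsub>M\<^esub>")
        case False
        obtain c where c: "\<sigma> y c \<noteq> \<zero>" "\<forall>p. \<sigma> y p \<noteq> \<zero> \<longrightarrow> (p, c) \<in> r"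
          using linear_order_finite_max[OF lin \<sigma>_finite[OF yM] \<sigma>_nonzero[OF yM False]] by auto
        \<comment> \<open>\<open>c\<close> is the leading index of \<open>y\<close>: at most
          \<open>b\<close> since \<open>y\<close> lies in \<open>below b\<close>, and different from
          \<open>b\<close> since the \<open>b\<close>-entry of \<open>y\<close> is zero.\<close>
        have "(c, b) \<in> r - Id" using c(1) y_b y_below by (auto simp: below_def)
        moreover have "y \<in> below c" using yM c(2) by (simp add: below_def)
        ultimately show ?thesis using less.IH by blast
      qed simp
      moreover have "x = y \<oplus>\<^bsub>M\<^esub> a' \<odot>\<^bsub>M\<^esub> k b"
        using xM a'(1) by (simp add: y_def M.smult_l_minus M.M.a_assoc M.M.l_neg)
      ultimately show "x \<in> M.span (k ` T)"
        using a'(2) by simp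
    qed
  qed
  have "x \<in> M.span (k ` T)" if x: "x \<in> carrier M" for x
  proof (cases "x = \<zero>\<^bsub>M\<^esub>")
    case False
    obtain c where "\<forall>p. \<sigma> x p \<noteq> \<zero> \<longrightarrow> (p, c) \<in> r"
      using linear_order_finite_max[OF lin \<sigma>_finite[OF x] \<sigma>_nonzero[OF x False]] by auto
    then have "x \<in> below c" using x by (simp add: below_def)
    then show ?thesis using below_span by blast
  qed simp
  then have "M.span (k ` T) = carrier M"
    using span.subset by blast
  then show ?thesis
    using assms(2) BM indep unfolding free_module_def by blast
qed

section \<open>Coordinates and lifting for free modules\<close>

text \<open>Evaluation at a basis is a bijective homomorphism, and \<open>\<sigma>\<close> is its
  inverse. Lifting needs only that \<open>\<sigma>\<close> is a homomorphism and a section of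
  evaluation.\<close>

lemma free_module_coordinates:
  fixes M :: "('a, 'm, 's) module_scheme"
  assumes "free_module R M"
  obtains B \<sigma> where "B \<subseteq> carrier M" "\<sigma> \<in> module_hom R M (finsupp_module R B)"
    "\<And>x. x \<in> carrier M \<Longrightarrow> finsupp_eval R M (\<lambda>b. b) (\<sigma> x) = x"
proof -
  interpret M: module R M
    using assms by (simp add: free_module_def)
  obtain B where B: "B \<subseteq> carrier M" "M.span B = carrier M" "\<not> M.lin_dep B"
    using assms by (auto simp: free_module_def)
  let ?F = "finsupp_module R B" and ?e = "finsupp_eval R M (\<lambda>b. b)"
  have F: "module R ?F" by (rule M.R.finsupp_module_is_module)
  have idB: "(\<lambda>b. b) \<in> B \<rightarrow> carrier M" using B(1) by auto
  have e: "?e \<in> module_hom R ?F M" by (rule M.finsupp_eval_hom[OF idB])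
  interpret F: module R ?F by (rule F)
  \<comment> \<open>\<open>?e c\<close> is the linear combination over the support of
    \<open>c\<close>, so a nonzero \<open>c\<close> in the kernel is a linear dependence in
    \<open>B\<close>.\<close>
  have ker: "c = \<zero>\<^bsub>?F\<^esub>" if c: "c \<in> carrier ?F" and "?e c = \<zero>\<^bsub>M\<^esub>" for c
  proof (rule ccontr)
    assume "c \<noteq> \<zero>\<^bsub>?F\<^esub>"
    then obtain v where "c v \<noteq> \<zero>\<^bsub>R\<^esub>" by (auto simp: finsupp_module_sel)
    then have "M.lin_dep B"
      using finsupp_moduleD[OF c] that(2)
      by (intro M.lin_dep_crit[of "{p. c p \<noteq> \<zero>\<^bsub>R\<^esub>}" B c v])
        (auto simp: finsupp_eval_def M.lincomb_def)
    then show False using B(3) by blast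
  qed
  have inj: "inj_on ?e (carrier ?F)"
  proof (rule inj_onI)
    fix c d assume c: "c \<in> carrier ?F" and d: "d \<in> carrier ?F" and eq: "?e c = ?e d"
    interpret e: mod_hom R ?F M ?e
      by unfold_locales (rule e)
    have "?e (c \<ominus>\<^bsub>?F\<^esub> d) = \<zero>\<^bsub>M\<^esub>"
      using c d eq by (simp add: M.M.r_neg M.M.minus_eq)
    then have "c \<ominus>\<^bsub>?F\<^esub> d = \<zero>\<^bsub>?F\<^esub>"
      using ker c d by simp
    then show "c = d" using c d by simp
  qed
  have surj: "?e ` carrier ?F = carrier M"
  proof
    show "?e ` carrier ?F \<subseteq> carrier M" using module_hom_closed[OF e] by auto
    show "carrier M \<subseteq> ?e ` carrier ?F"
    proof
      fix x assume "x \<in> carrier M"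
      then obtain A a where A: "finite A" "A \<subseteq> B" "a \<in> A \<rightarrow> carrier R" "x = M.lincomb a A"
        unfolding B(2)[symmetric] M.span_def by auto
      \<comment> \<open>The coefficients \<open>a\<close> are arbitrary outside \<open>A\<close>;
        cutting them off by zero makes the support finite.\<close>
      let ?c = "\<lambda>p. if p \<in> A then a p else \<zero>\<^bsub>R\<^esub>"
      have c: "?c \<in> carrier ?F"
        using A by (auto simp: finsupp_module_def intro: finite_subset[of _ A])
      have "?e ?c = (\<Oplus>\<^bsub>M\<^esub>p\<in>A. ?c p \<odot>\<^bsub>M\<^esub> p)"
        using A by (intro M.finsupp_eval_superset[OF c idB]) auto
      also have "\<dots> = x"
        unfolding A(4) M.lincomb_def using A B(1) by (intro M.M.finsum_cong') (auto simp: Pi_iff)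
      finally show "x \<in> ?e ` carrier ?F" using c by force
    qed
  qed
  show thesis
  proof (rule that[OF B(1)])
    show "inv_into (carrier ?F) ?e \<in> module_hom R M ?F"
      by (rule module_hom_inv_into[OF F e inj surj])
    show "?e (inv_into (carrier ?F) ?e x) = x" if "x \<in> carrier M" for x
      using that surj by (simp add: f_inv_into_f)
  qed
qed

text \<open>Preimages under \<open>g\<close> of the values of \<open>f\<close> on a basis are chosen
  freely and extended linearly through the coordinates. The carrier types of \<open>A\<close> and
  \<open>B\<close> stay arbitrary, so the test types of \<open>projective_module\<close> are
  covered.\<close>

lemma free_module_lifts:
  assumes free: "free_module R P" and A: "module R A" and B: "module R B"
  shows "lifts_along_epis R P A B"
  unfolding lifts_along_epis_def
proof (intro ballI impI)
  fix g f
  assume g: "g \<in> module_hom R A B" and surj: "g ` carrier A = carrier B"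
    and f: "f \<in> module_hom R P B"
  have P: "module R P" using free by (simp add: free_module_def)
  obtain X \<sigma> where X: "X \<subseteq> carrier P" and \<sigma>: "\<sigma> \<in> module_hom R P (finsupp_module R X)"
    and ev: "\<And>x. x \<in> carrier P \<Longrightarrow> finsupp_eval R P (\<lambda>b. b) (\<sigma> x) = x"
    using free_module_coordinates[OF free] by blast
  interpret A: module R A by fact
  interpret B: module R B by fact
  have "\<exists>a\<in>carrier A. g a = f p" if "p \<in> X" for p
  proof -
    have "f p \<in> g ` carrier A" using module_hom_closed[OF f] that X by (auto simp: surj)
    then show ?thesis by auto
  qed
  then obtain \<phi> where \<phi>: "\<And>p. p \<in> X \<Longrightarrow> \<phi> p \<in> carrier A \<and> g (\<phi> p) = f p"
    by metis
  show "\<exists>h\<in>module_hom R P A. \<forall>x\<in>carrier P. g (h x) = f x"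
  proof (intro bexI ballI)
    show "finsupp_eval R A \<phi> \<circ> \<sigma> \<in> module_hom R P A"
      using \<phi> by (intro module_hom_comp[OF \<sigma>] A.finsupp_eval_hom) auto
    fix x assume x: "x \<in> carrier P"
    have \<sigma>x: "\<sigma> x \<in> carrier (finsupp_module R X)" using module_hom_closed[OF \<sigma>] x by auto
    have "g ((finsupp_eval R A \<phi> \<circ> \<sigma>) x) = finsupp_eval R B (\<lambda>p. g (\<phi> p)) (\<sigma> x)"
      unfolding comp_def using \<phi> by (intro module_hom_finsupp_eval[OF A B g \<sigma>x]) auto
    also have "\<dots> = finsupp_eval R B f (\<sigma> x)"
      unfolding finsupp_eval_def
      using \<phi> X finsupp_moduleD[OF \<sigma>x] module_hom_closed[OF f]
      by (intro B.M.finsum_cong') (auto simp: Pi_iff subset_iff)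
    also have "\<dots> = f (finsupp_eval R P (\<lambda>b. b) (\<sigma> x))"
      using X by (intro module_hom_finsupp_eval[OF P B f \<sigma>x, symmetric]) auto
    finally show "g ((finsupp_eval R A \<phi> \<circ> \<sigma>) x) = f x" using ev[OF x] by simp
  qed
qed

lemma free_imp_projective_module: "free_module R P \<Longrightarrow> projective_module R P"
  using free_module_lifts[of R P] unfolding projective_module_def free_module_def by blast

section \<open>Projective modules and their submodules\<close>

text \<open>The identity of \<open>P\<close> lifts along the evaluation of finitely supported
  families on \<open>carrier P\<close>. The lift is a section of that evaluation, hence
  injective.\<close>

lemma projective_module_embedding:
  assumes "projective_module R P"
  obtains \<sigma> where "\<sigma> \<in> module_hom R P (finsupp_module R (carrier P))" "inj_on \<sigma> (carrier P)"
proof -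
  interpret P: module R P
    using assms by (simp add: projective_module_def)
  let ?F = "finsupp_module R (carrier P)" and ?e = "finsupp_eval R P (\<lambda>p. p)"
  have e: "?e \<in> module_hom R ?F P"
    by (rule P.finsupp_eval_hom) auto
  have surj: "?e ` carrier ?F = carrier P"
  proof
    show "?e ` carrier ?F \<subseteq> carrier P" using module_hom_closed[OF e] by auto
    show "carrier P \<subseteq> ?e ` carrier ?F"
      using P.finsupp_eval_unit[of _ "carrier P" "\<lambda>p. p"] by (force simp: image_iff)
  qed
  have "lifts_along_epis R P ?F P"
    using assms P.module_axioms P.R.finsupp_module_is_module by (intro projective_module_lifts)
  moreover have "(\<lambda>x. x) \<in> module_hom R P P"
    by (simp add: module_hom_def)
  ultimately obtain \<sigma> where "\<sigma> \<in> module_hom R P ?F" and "\<And>x. x \<in> carrier P \<Longrightarrow> ?e (\<sigma> x) = x"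
    using e surj unfolding lifts_along_epis_def by meson
  then show thesis
    by (intro that[of \<sigma>] inj_on_inverseI)
qed

text \<open>The embedding of \<open>P\<close> restricts to \<open>K\<close>, which gives
  \<open>K\<close> a basis by \<open>free_module_of_embedding\<close>.\<close>

lemma submodule_of_projective_is_free:
  assumes "principal_domain R" and P: "projective_module R P" and K: "submodule R K P"
  shows "free_module R (P\<lparr>carrier := K\<rparr>)"
proof -
  obtain \<sigma> where \<sigma>: "\<sigma> \<in> module_hom R P (finsupp_module R (carrier P))" "inj_on \<sigma> (carrier P)"
    using projective_module_embedding[OF P] by blast
  interpret P: module R P
    using P by (simp add: projective_module_def)
  show ?thesis
    using inj_on_subset[OF \<sigma>(2) submodule.subset[OF K]]
    by (intro free_module_of_embedding[OF assms(1) P.submodule_is_module[OF K]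
          module_hom_submodule[OF K \<sigma>(1)]]) simp
qed

lemma projective_iff_free_module:
  assumes "principal_domain R"
  shows "projective_module R P \<longleftrightarrow> free_module R P"
proof
  assume P: "projective_module R P"
  then have "module R P" by (simp add: projective_module_def)
  then show "free_module R P"
    using projective_module_embedding[OF P] free_module_of_embedding[OF assms] by metis
qed (rule free_imp_projective_module)

theorem proposition8:
  fixes R :: "('a, 'r) ring_scheme" and N :: "('a, 'n, 's) module_scheme"
  assumes "principal_domain R" and "module R N"
  shows
    "((\<forall>F :: ('a, 'm) module. free_module R F \<longrightarrow> Red_injective R N F) \<longrightarrow>
        (\<forall>F :: ('a, 'm) module. free_module R F \<longrightarrow>
           (\<forall>K. submodule R K F \<longrightarrow> Red_injective R N (F\<lparr>carrier := K\<rparr>)))) \<and>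
     ((\<forall>P :: ('a, 'm) module. projective_module R P \<longrightarrow> Red_injective R N P) \<longrightarrow>
        (\<forall>P :: ('a, 'm) module. projective_module R P \<longrightarrow>
           (\<forall>K. submodule R K P \<longrightarrow> Red_injective R N (P\<lparr>carrier := K\<rparr>)))) \<and>
     ((\<forall>P :: ('a, 'm) module. projective_module R P \<longrightarrow> Red_injective R N P) \<longleftrightarrow>
        (\<forall>F :: ('a, 'm) module. free_module R F \<longrightarrow> Red_injective R N F))"
  \<comment> \<open>A submodule of a free or projective module is again free and projective, and
    \<open>F\<lparr>carrier := K\<rparr>\<close> keeps the type of \<open>F\<close>, so each
    injectivity hypothesis can be instantiated at it directly.\<close>
  using submodule_of_projective_is_free[OF assms(1)] projective_iff_free_module[OF assms(1)]
  by blast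

end
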